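(* Let $r\ge 3$ be odd, let $n\ge r+1$, and let $m$ be an integer with $r+1\le m\le n$. Let $g=\Psi_{2,n}^{(r-1,r)}f$ for some $f\in\mathcal{H}_n^{(r-1)}(\mathbb{F}_2)$, where $(\Psi_{2,n}^{(r-1,r)}f)(e)=\sum_{e'\subseteq e,\ |e'|=r-1} f(e')$ for every $r$-element subset $e$ of the vertex set $V$. Then $K_m^{(r)}-e$ never occurs as an induced subhypergraph in either color of $g$; that is, there is no $m$-element set $X\subseteq V$ and color $c\in\mathbb{F}_2$ such that exactly one $r$-element subset of $X$ has $g$-color different from $c$ and all other $r$-element subsets of $X$ have $g$-color $c$.
   Context: $\mathbb{F}_2$ is the field with two elements. For $2\le k\le n$, $K_n^{(k)}$ is the complete $k$-uniform hypergraph on a fixed $n$-element vertex set $V$ (hyperedges: all $k$-element subsets of $V$), and $\mathcal{H}_n^{(k)}(\mathbb{F}_2)$ is the set of all maps $E(K_n^{(k)})\to\mathbb{F}_2$. $K_m^{(r)}-e$ denotes the complete $r$-uniform hypergraph on $m$ vertices with one hyperedge removed. *)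

theory Defs
  imports "HOL-Library.Z2" "HOL-Library.FuncSet"
begin

definition complete_edges :: "'a set \<Rightarrow> nat \<Rightarrow> 'a set set" where
  "complete_edges V k = {e. e \<subseteq> V \<and> card e = k}"

text \<open>
  \<^typ>\<open>bit\<close> is the field with two elements. Maps defined only on the hyperedges are
  represented as extensional functions.
\<close>

definition colorings :: "'a set \<Rightarrow> nat \<Rightarrow> ('a set \<Rightarrow> bit) set" where
  "colorings V k = complete_edges V k \<rightarrow>\<^sub>E UNIV"

definition Psi :: "'a set \<Rightarrow> nat \<Rightarrow> nat \<Rightarrow> ('a set \<Rightarrow> bit) \<Rightarrow> ('a set \<Rightarrow> bit)" where
  "Psi V k r f = (\<lambda>e\<in>complete_edges V r. \<Sum>e'\<in>complete_edges e k. f e')"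

end

theory Submission
  imports Defs
begin

text \<open>
  On an \<open>(r + 1)\<close>-set \<open>Y\<close>, every \<open>(r - 1)\<close>-subset lies in exactly two \<open>r\<close>-subsets, so over the
  field with two elements the values of \<open>g\<close> on the \<open>r\<close>-subsets of \<open>Y\<close> sum to \<open>0\<close>. If all but one
  of these \<open>r + 1\<close> values were \<open>c\<close> and the remaining one were \<open>c + 1\<close>, they would sum to
  \<open>(r + 1) c + 1\<close>, which is \<open>1\<close> as \<open>r\<close> is odd. Any \<open>Y\<close> between the exceptional edge and \<open>X\<close> thus
  gives a contradiction.
\<close>

lemma finite_complete_edges: "finite V \<Longrightarrow> finite (complete_edges V k)"
  by (simp add: complete_edges_def)

lemma card_complete_edges: "finite V \<Longrightarrow> card (complete_edges V k) = card V choose k"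
  by (simp add: complete_edges_def n_subsets)

lemma complete_edges_mono: "U \<subseteq> V \<Longrightarrow> complete_edges U k \<subseteq> complete_edges V k"
  by (auto simp: complete_edges_def)

lemma bij_betw_Un_complete_edges:
  assumes "finite V" "d \<in> complete_edges V k" "k \<le> r"
  shows "bij_betw (\<lambda>s. s \<union> d) (complete_edges (V - d) (r - k)) {e \<in> complete_edges V r. d \<subseteq> e}"
proof (rule bij_betw_byWitness[where f' = "\<lambda>e. e - d"])
  have d: "d \<subseteq> V" "card d = k" "finite d"
    using assms by (auto simp: complete_edges_def intro: finite_subset)
  show "(\<lambda>s. s \<union> d) ` complete_edges (V - d) (r - k) \<subseteq> {e \<in> complete_edges V r. d \<subseteq> e}"
  proof (intro image_subsetI)
    fix s assume "s \<in> complete_edges (V - d) (r - k)"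
    then have s: "s \<subseteq> V - d" "card s = r - k"
      by (auto simp: complete_edges_def)
    then have "card (s \<union> d) = r"
      using d assms by (subst card_Un_disjoint) (auto intro: finite_subset)
    with s d show "s \<union> d \<in> {e \<in> complete_edges V r. d \<subseteq> e}"
      by (auto simp: complete_edges_def)
  qed
  show "(\<lambda>e. e - d) ` {e \<in> complete_edges V r. d \<subseteq> e} \<subseteq> complete_edges (V - d) (r - k)"
    using d by (auto simp: complete_edges_def card_Diff_subset)
qed (auto simp: complete_edges_def)

lemma card_complete_edges_supersets:
  assumes "finite V" "d \<in> complete_edges V k" "k \<le> r"
  shows "card {e \<in> complete_edges V r. d \<subseteq> e} = (card V - k) choose (r - k)"
proof -
  have "card {e \<in> complete_edges V r. d \<subseteq> e} = card (complete_edges (V - d) (r - k))"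
    using bij_betw_Un_complete_edges[OF assms] by (rule bij_betw_same_card[symmetric])
  also have "\<dots> = card (V - d) choose (r - k)"
    using assms(1) by (simp add: card_complete_edges)
  also have "card (V - d) = card V - k"
    using assms by (auto simp: complete_edges_def card_Diff_subset finite_subset)
  finally show ?thesis .
qed

lemma sum_sum_complete_edges:
  fixes f :: "'a set \<Rightarrow> 'b::comm_semiring_1"
  assumes "finite V" "k \<le> r"
  shows "(\<Sum>e\<in>complete_edges V r. \<Sum>d\<in>complete_edges e k. f d)
    = of_nat ((card V - k) choose (r - k)) * (\<Sum>d\<in>complete_edges V k. f d)"
proof -
  have "(\<Sum>e\<in>complete_edges V r. \<Sum>d\<in>complete_edges e k. f d)
      = (\<Sum>e\<in>complete_edges V r. \<Sum>d\<in>{d \<in> complete_edges V k. d \<subseteq> e}. f d)"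
    by (intro sum.cong) (auto simp: complete_edges_def)
  also have "\<dots> = (\<Sum>d\<in>complete_edges V k. \<Sum>e\<in>{e \<in> complete_edges V r. d \<subseteq> e}. f d)"
    using assms(1) by (intro sum.swap_restrict finite_complete_edges)
  also have "\<dots> = (\<Sum>d\<in>complete_edges V k. of_nat ((card V - k) choose (r - k)) * f d)"
    using assms by (intro sum.cong) (simp_all only: sum_constant card_complete_edges_supersets)
  finally show ?thesis
    by (simp only: sum_distrib_left)
qed

lemma sum_Psi:
  assumes "finite U" "U \<subseteq> V" "k \<le> r"
  shows "(\<Sum>e\<in>complete_edges U r. Psi V k r f e)
    = of_nat ((card U - k) choose (r - k)) * (\<Sum>d\<in>complete_edges U k. f d)"
proof -
  have "(\<Sum>e\<in>complete_edges U r. Psi V k r f e)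
      = (\<Sum>e\<in>complete_edges U r. \<Sum>d\<in>complete_edges e k. f d)"
    using complete_edges_mono[OF assms(2)] by (intro sum.cong) (auto simp: Psi_def)
  then show ?thesis
    using sum_sum_complete_edges[OF assms(1,3), of f] by (rule trans)
qed

lemma of_nat_bit_eq_0: "even n \<Longrightarrow> of_nat n = (0 :: bit)"
  by (elim evenE) (simp only: of_nat_mult of_nat_numeral bit_2_eq_0 mult_zero_left)

lemma sum_Psi_Suc_eq_0:
  assumes "U \<subseteq> V" "card U = k + 2"
  shows "(\<Sum>e\<in>complete_edges U (Suc k). Psi V k (Suc k) f e) = 0"
proof -
  have "finite U"
    using assms(2) by (simp add: card_ge_0_finite)
  moreover have "(card U - k) choose (Suc k - k) = 2"
    using assms(2) by simp
  ultimately show ?thesis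
    using assms(1)
    by (simp only: sum_Psi lessI less_imp_le of_nat_bit_eq_0 even_numeral mult_zero_left)
qed

lemma sum_eq_const_except:
  fixes g :: "'b \<Rightarrow> 'a::ring_1"
  assumes "finite A" "a \<in> A" "\<And>x. x \<in> A - {a} \<Longrightarrow> g x = c"
  shows "sum g A = of_nat (card A) * c + (g a - c)"
proof -
  have "sum g A = g a + of_nat (card A - 1) * c"
    using assms by (simp add: sum.remove)
  also have "of_nat (card A - 1) * c = of_nat (card A) * c - c"
    using assms(1,2) by (cases "card A") (auto simp: algebra_simps)
  finally show ?thesis by simp
qed

lemma bit_eq_const_if_sum_eq_0:
  fixes g :: "'b \<Rightarrow> bit"
  assumes "finite A" "even (card A)" "sum g A = 0"
    and "a \<in> A" "\<And>x. x \<in> A - {a} \<Longrightarrow> g x = c"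
  shows "g a = c"
proof -
  have "0 = of_nat (card A) * c + (g a - c)"
    using sum_eq_const_except[OF assms(1,4,5)] assms(3) by (simp only:)
  also have "\<dots> = g a - c"
    by (simp only: of_nat_bit_eq_0[OF assms(2)] mult_zero_left add_0_left)
  finally show ?thesis
    by (metis right_minus_eq)
qed

theorem theorem7:
  fixes V :: "'a set" and n r m :: nat and f g :: "'a set \<Rightarrow> bit"
  assumes "finite V" and "card V = n"
    and "r \<ge> 3" and "odd r" and "n \<ge> r + 1"
    and "r + 1 \<le> m" and "m \<le> n"
    and "f \<in> colorings V (r - 1)"
    and "g = Psi V (r - 1) r f"
  shows "\<not> (\<exists>X c. X \<subseteq> V \<and> card X = m \<and>
           (\<exists>e\<in>complete_edges X r. g e \<noteq> c \<and>
              (\<forall>e'\<in>complete_edges X r - {e}. g e' = c)))"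
proof (intro notI, elim exE conjE bexE)
  fix X c e
  assume X: "X \<subseteq> V" "card X = m" and e: "e \<in> complete_edges X r"
    and ne: "g e \<noteq> c" and const: "\<forall>e'\<in>complete_edges X r - {e}. g e' = c"
  have "finite X" using X(1) assms(1) by (rule finite_subset)
  then obtain Y where Y: "e \<subseteq> Y" "Y \<subseteq> X" "card Y = r + 1"
    using exists_subset_between[of e "r + 1" X] e X(2) assms(6) by (auto simp: complete_edges_def)
  have "finite Y" using Y(2) \<open>finite X\<close> by (rule finite_subset)
  have "even (card (complete_edges Y r))"
    using \<open>finite Y\<close> Y(3) assms(4) by (simp add: card_complete_edges)
  moreover have "sum g (complete_edges Y r) = 0"
    using sum_Psi_Suc_eq_0[of Y V "r - 1" f] X(1) Y(2,3) assms(3,9) by force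
  moreover have "e \<in> complete_edges Y r"
    using e Y(1) by (simp add: complete_edges_def)
  moreover have "g e' = c" if "e' \<in> complete_edges Y r - {e}" for e'
    using const that complete_edges_mono[OF Y(2)] by blast
  ultimately have "g e = c"
    by (rule bit_eq_const_if_sum_eq_0[OF finite_complete_edges[OF \<open>finite Y\<close>]])
  with ne show False by blast
qed

end
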